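(* Let $\mathfrak{g}$ be a finite-dimensional nilpotent Lie algebra over a field $\mathbb{K}$ of characteristic $0$, whose characteristic sequence is $c(\mathfrak{g})=(c_1,\dots,c_k,1)$. Then its breadth satisfies $$b(\mathfrak{g})=\sum_{i=1}^k c_i-k.$$
   Context: Breadth: $b(\mathfrak{g})=\max\{\operatorname{rank}(\operatorname{ad} X)\;:\; X\in\mathfrak{g}\}$. Characteristic sequence: let $\mathfrak{g}$ be a finite-dimensional nilpotent Lie algebra and $\mathcal{C}^1(\mathfrak{g})=[\mathfrak{g},\mathfrak{g}]$ its derived subalgebra. For $X\in\mathfrak{g}$ let $c(X)$ be the sequence, in decreasing order, of the dimensions of the Jordan blocks of the nilpotent operator $\operatorname{ad}X$. Then $c(\mathfrak{g})=\max\{c(X): X\in\mathfrak{g}\setminus\mathcal{C}^1(\mathfrak{g})\}$, the maximum being taken for the lexicographic order. It has the form $(c_1,\dots,c_k,1)$ with $c_1\ge\cdots\ge c_k\ge 1$ and $c_1+\cdots+c_k+1=\dim\mathfrak{g}$. *)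

theory Defs
  imports
    "Jordan_Normal_Form.Jordan_Normal_Form"
    "HOL-Library.List_Lexorder"
begin

locale lie_algebra = vector_space scale
  for scale :: "'k::field \<Rightarrow> 'g::ab_group_add \<Rightarrow> 'g" (infixr \<open>*s\<close> 75) +
  fixes bracket :: "'g \<Rightarrow> 'g \<Rightarrow> 'g"
  assumes bracket_linear_left: "Vector_Spaces.linear scale scale (\<lambda>x. bracket x y)"
    and bracket_linear_right: "Vector_Spaces.linear scale scale (\<lambda>y. bracket x y)"
    and bracket_self: "bracket x x = 0"
    and jacobi: "bracket x (bracket y z) + bracket y (bracket z x) + bracket z (bracket x y) = 0"
begin

definition is_ordered_basis :: "'g list \<Rightarrow> bool" where
  "is_ordered_basis bs \<longleftrightarrow> distinct bs \<and> independent (set bs) \<and> span (set bs) = UNIV"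

definition matrix_of :: "'g list \<Rightarrow> ('g \<Rightarrow> 'g) \<Rightarrow> 'k mat" where
  "matrix_of bs T =
     mat (length bs) (length bs) (\<lambda>(i, j). representation (set bs) (T (bs ! j)) (bs ! i))"

definition rank :: "('g \<Rightarrow> 'g) \<Rightarrow> nat" where
  "rank T = dim (range T)"

text \<open>
  Only meaningful for endomorphisms of a finite-dimensional space that possess a Jordan normal
  form over the ground field, in particular for nilpotent ones. The result does not depend on the
  ordered basis, since \<^const>\<open>jordan_nf\<close> is invariant under similarity.
\<close>
definition jordan_block_sizes :: "('g \<Rightarrow> 'g) \<Rightarrow> nat list" where
  "jordan_block_sizes T =
     (THE ns. \<exists>bs n_as. is_ordered_basis bs \<and> jordan_nf (matrix_of bs T) n_as \<and>
                ns = rev (sort (map fst n_as)))"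

definition ad :: "'g \<Rightarrow> 'g \<Rightarrow> 'g" where
  "ad x = (\<lambda>y. bracket x y)"

definition bracket_span :: "'g set \<Rightarrow> 'g set \<Rightarrow> 'g set" where
  "bracket_span A B = span {bracket a b | a b. a \<in> A \<and> b \<in> B}"

definition derived_subalgebra :: "'g set" where
  "derived_subalgebra = bracket_span UNIV UNIV"

primrec lower_central :: "nat \<Rightarrow> 'g set" where
  "lower_central 0 = UNIV"
| "lower_central (Suc m) = bracket_span UNIV (lower_central m)"

definition nilpotent :: bool where
  "nilpotent \<longleftrightarrow> (\<exists>m. lower_central m = {0})"

definition breadth :: nat where
  "breadth = Max {rank (ad x) | x. True}"

text \<open>
  The maximum is with respect to the lexicographic order on lists. For a nilpotent algebra it is
  taken over the empty set only if the algebra is zero; the zero algebra gets the empty sequence.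
\<close>
definition characteristic_sequence :: "nat list" where
  "characteristic_sequence =
     (if derived_subalgebra = UNIV then []
      else Max {jordan_block_sizes (ad x) | x. x \<notin> derived_subalgebra})"

end

locale finite_dimensional_lie_algebra = lie_algebra +
  assumes finite_dimensional: "\<exists>B. finite B \<and> span B = UNIV"

end

theory Submission
  imports Defs
    "Jordan_Normal_Form.Jordan_Normal_Form_Existence"
    "Jordan_Normal_Form.Jordan_Normal_Form_Uniqueness"
begin

text \<open>
  If a nilpotent operator \<open>T\<close> has Jordan blocks of sizes \<open>n\<^sub>1, \<dots>, n\<^sub>r\<close>, then
  \<open>dim (ker T^j) = min j n\<^sub>1 + \<dots> + min j n\<^sub>r\<close> for every \<open>j\<close>. The case \<open>j = 1\<close> says that the rank of
  \<open>T\<close> is the sum of the block sizes minus their number. So what has to be shown is that an element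
  \<open>X\<close> outside the derived subalgebra whose block sizes are lexicographically maximal also maximises
  the rank of \<open>ad X\<close>. This needs an argument, because the lexicographic order by itself does not
  control the number of blocks: \<open>(4,1,1) > (3,3)\<close>, although three blocks mean a smaller rank.

  The argument is genericity. On the line \<open>X + t (Y - X)\<close> the entries of \<open>(ad (X + t (Y - X)))^j\<close> are
  polynomials in \<open>t\<close>, so its rank falls below its value at any chosen parameter for only finitely many
  \<open>t\<close> (\<open>finite_rank_drop_parameters\<close>). The line meets the derived subalgebra in at most one point, and
  only the finitely many \<open>j\<close> below the nilpotency index matter. As the field is infinite, some \<open>Z\<close> on
  the line lies outside the derived subalgebra, has \<open>rank (ad Z)^j \<ge> rank (ad X)^j\<close> for all \<open>j\<close>
  (parameter \<open>t = 0\<close>) and \<open>rank (ad Z) \<ge> rank (ad Y)\<close> (parameter \<open>t = 1\<close>); this is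
  \<open>exists_common_rank_bound\<close>.

  Larger ranks of all powers mean that the block sizes of \<open>Z\<close> dominate those of \<open>X\<close>, and the
  lexicographic order refines the dominance order (\<open>lex_le_if_min_sums_ge\<close>). By maximality of \<open>X\<close> the
  block sizes of \<open>X\<close> and \<open>Z\<close> then agree, and \<open>rank (ad Y) \<le> rank (ad Z) = rank (ad X)\<close>.
\<close>

section \<open>Dominance and the lexicographic order on partitions\<close>

text \<open>
  At the first place where the lists differ, the witness \<open>j\<close> is the entry of the smaller list. That
  list is decreasing, so truncating at \<open>j\<close> leaves its remaining entries unchanged, while it shortens
  the larger entry of the other list; the two tails have the same sum.
\<close>

lemma exists_min_sum_less_if_lex_less:
  fixes ns ms :: "nat list"
  assumes "sorted_wrt (\<ge>) ns" and "0 \<notin> set ms" and "sum_list ns = sum_list ms" and "ns < ms"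
  shows "\<exists>j. (\<Sum>m\<leftarrow>ms. min j m) < (\<Sum>n\<leftarrow>ns. min j n)"
  using assms
proof (induction ns arbitrary: ms)
  case Nil
  then show ?case by (cases ms) auto
next
  case (Cons n ns)
  obtain m ms' where ms: "ms = m # ms'"
    using Cons.prems(4) by (cases ms) (auto simp: list_less_def)
  consider "n < m" | "n = m" "ns < ms'"
    using Cons.prems(4) by (auto simp: ms list_less_def)
  then show ?case
  proof cases
    case 1
    have "(\<Sum>k\<leftarrow>n # ns. min n k) = sum_list (n # ns)"
      using Cons.prems(1) by (intro arg_cong[where f = sum_list] map_idI) auto
    moreover have "(\<Sum>k\<leftarrow>ms'. min n k) \<le> sum_list ms'"
      using sum_list_mono[of ms' "min n" "\<lambda>k. k"] by simp
    then have "(\<Sum>k\<leftarrow>ms. min n k) < sum_list ms"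
      using 1 by (simp add: ms)
    ultimately show ?thesis
      using Cons.prems(3) by metis
  next
    case 2
    then show ?thesis
      using Cons.IH[of ms'] Cons.prems by (auto simp: ms)
  qed
qed

text \<open>
  The sums \<open>\<Sum>n\<leftarrow>ns. min j n\<close> are the partial sums of the conjugate partition, so the last hypothesis
  is the dominance order, read on conjugates.
\<close>

lemma lex_le_if_min_sums_ge:
  fixes ns ms :: "nat list"
  assumes "sorted_wrt (\<ge>) ns" and "0 \<notin> set ms" and "sum_list ns = sum_list ms"
    and "\<And>j. (\<Sum>n\<leftarrow>ns. min j n) \<le> (\<Sum>m\<leftarrow>ms. min j m)"
  shows "ms \<le> ns"
  using exists_min_sum_less_if_lex_less[OF assms(1-3)] assms(4) by (meson not_le)

text \<open>
  The number of parts of size at least \<open>j\<close> is the \<open>j\<close>-th increment of these sums, so they determine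
  the partition; here this follows from antisymmetry of the lexicographic order. It is what makes
  the block sizes of a nilpotent operator independent of the chosen basis.
\<close>

lemma min_sums_eq_imp_eq:
  fixes ns ms :: "nat list"
  assumes "sorted_wrt (\<ge>) ns" "0 \<notin> set ns" "sorted_wrt (\<ge>) ms" "0 \<notin> set ms"
    and eq: "\<And>j. (\<Sum>n\<leftarrow>ns. min j n) = (\<Sum>m\<leftarrow>ms. min j m)"
  shows "ns = ms"
proof -
  define N where "N = sum_list ns + sum_list ms"
  have "map (min N) ns = ns" "map (min N) ms = ms"
    by (auto intro!: map_idI simp: N_def dest: member_le_sum_list)
  then have "sum_list ns = sum_list ms"
    using eq[of N] by simp
  then show ?thesis
    using lex_le_if_min_sums_ge[of ns ms] lex_le_if_min_sums_ge[of ms ns] assms by fastforce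
qed

section \<open>Coordinates with respect to an ordered basis\<close>

locale ordered_basis = vector_space scale
  for scale :: "'k::field \<Rightarrow> 'g::ab_group_add \<Rightarrow> 'g" (infixr \<open>*s\<close> 75) +
  fixes bs :: "'g list"
  assumes distinct_bs: "distinct bs"
    and independent_bs: "independent (set bs)"
    and span_bs: "span (set bs) = UNIV"
begin

sublocale finite_dimensional_vector_space scale "set bs"
  by unfold_locales (auto simp: independent_bs span_bs)

definition coords :: "'g \<Rightarrow> 'k vec" where
  "coords x = vec (length bs) (\<lambda>i. representation (set bs) x (bs ! i))"

definition op_mat :: "('g \<Rightarrow> 'g) \<Rightarrow> 'k mat" where
  "op_mat T =
     mat (length bs) (length bs) (\<lambda>(i, j). representation (set bs) (T (bs ! j)) (bs ! i))"

lemma coords_carrier [simp]: "coords x \<in> carrier_vec (length bs)"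
  by (simp add: coords_def)

lemma dim_coords [simp]: "dim_vec (coords x) = length bs"
  by (simp add: coords_def)

lemma op_mat_carrier [simp]: "op_mat T \<in> carrier_mat (length bs) (length bs)"
  by (simp add: op_mat_def)

lemma coords_index: "i < length bs \<Longrightarrow> coords x $ i = representation (set bs) x (bs ! i)"
  by (simp add: coords_def)

lemma coords_sum_index:
  "i < length bs \<Longrightarrow> coords (\<Sum>b\<in>B. c b *s f b) $ i = (\<Sum>b\<in>B. c b * coords (f b) $ i)"
  by (simp add: coords_index representation_sum representation_scale independent_bs span_bs)

lemma coords_add_index:
  "i < length bs \<Longrightarrow> coords (x + y) $ i = coords x $ i + coords y $ i"
  by (simp add: coords_index representation_add independent_bs span_bs)

lemma coords_scale_index:
  "i < length bs \<Longrightarrow> coords (a *s x) $ i = a * coords x $ i"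
  by (simp add: coords_index representation_scale independent_bs span_bs)

lemma sum_coords: "(\<Sum>i<length bs. coords x $ i *s bs ! i) = x"
proof -
  have "(\<Sum>i<length bs. coords x $ i *s bs ! i) = (\<Sum>b\<in>set bs. representation (set bs) x b *s b)"
    using sum.reindex_bij_betw[OF bij_betw_nth[OF distinct_bs refl refl],
        of "\<lambda>b. representation (set bs) x b *s b"] by (simp add: coords_index)
  then show ?thesis
    by (simp add: sum_representation_eq independent_bs span_bs)
qed

lemma coords_eq_iff [simp]: "coords x = coords y \<longleftrightarrow> x = y"
  using sum_coords by metis

lemma coords_zero [simp]: "coords 0 = 0\<^sub>v (length bs)"
  by (rule eq_vecI) (auto simp: coords_def representation_zero)

lemma coords_eq_zero_iff [simp]: "coords x = 0\<^sub>v (length bs) \<longleftrightarrow> x = 0"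
  using coords_eq_iff[of x 0] by simp

lemma exists_coords_eq:
  assumes "v \<in> carrier_vec (length bs)"
  shows "\<exists>x. coords x = v"
proof
  have basis: "coords (bs ! j) $ i = (if i = j then 1 else 0)"
    if "i < length bs" "j < length bs" for i j
    using that distinct_bs by (simp add: coords_index representation_basis independent_bs nth_eq_iff_index_eq)
  show "coords (\<Sum>j<length bs. v $ j *s bs ! j) = v"
  proof (rule eq_vecI)
    fix i assume "i < dim_vec v"
    then have i: "i < length bs" using assms by simp
    have "coords (\<Sum>j<length bs. v $ j *s bs ! j) $ i = (\<Sum>j<length bs. if i = j then v $ j else 0)"
      unfolding coords_sum_index[OF i] by (intro sum.cong) (auto simp: basis i)
    then show "coords (\<Sum>j<length bs. v $ j *s bs ! j) $ i = v $ i"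
      using i by simp
  qed (use assms in \<open>simp add: coords_def\<close>)
qed

lemma coords_image_op:
  assumes "Vector_Spaces.linear scale scale T" and "i < length bs"
  shows "coords (T x) $ i = (\<Sum>j<length bs. coords x $ j * coords (T (bs ! j)) $ i)"
proof -
  interpret T: Vector_Spaces.linear scale scale T by fact
  have "T x = (\<Sum>j<length bs. coords x $ j *s T (bs ! j))"
    using arg_cong[OF sum_coords[of x], of T] by (simp add: T.sum T.scale)
  then show ?thesis
    using assms(2) by (simp add: coords_sum_index)
qed

lemma op_mat_mult_coords:
  assumes "Vector_Spaces.linear scale scale T"
  shows "op_mat T *\<^sub>v coords x = coords (T x)"
proof (rule eq_vecI)
  fix i assume "i < dim_vec (coords (T x))"
  then have i: "i < length bs" by (simp add: coords_def)
  have "(op_mat T *\<^sub>v coords x) $ i = (\<Sum>j<length bs. coords (T (bs ! j)) $ i * coords x $ j)"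
    using i by (simp add: op_mat_def scalar_prod_def coords_index lessThan_atLeast0)
  then show "(op_mat T *\<^sub>v coords x) $ i = coords (T x) $ i"
    by (simp add: coords_image_op[OF assms i, of x] mult.commute)
qed (simp add: op_mat_def coords_def)

lemma op_mat_pow_mult_coords:
  assumes "Vector_Spaces.linear scale scale T"
  shows "op_mat T ^\<^sub>m k *\<^sub>v coords x = coords ((T ^^ k) x)"
proof (induction k arbitrary: x)
  case 0
  show ?case by (simp add: op_mat_def coords_def)
next
  case (Suc k)
  have "op_mat T ^\<^sub>m Suc k *\<^sub>v coords x = op_mat T ^\<^sub>m k *\<^sub>v (op_mat T *\<^sub>v coords x)"
    by (simp add: assoc_mult_mat_vec[of _ "length bs" "length bs" _ "length bs"])
  then show ?case
    by (simp add: op_mat_mult_coords[OF assms] Suc funpow_swap1)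
qed

text \<open>
  The bridge between kernels of matrices, whose dimension is taken in a module with explicit carrier,
  and subspaces of the vector space: \<open>coords\<close> maps a basis of \<open>K\<close> to a basis of the matrix kernel.
\<close>

lemma kernel_dim_eq_dim:
  assumes A: "A \<in> carrier_mat (length bs) (length bs)" and K: "subspace K"
    and ker: "\<And>x. A *\<^sub>v coords x = 0\<^sub>v (length bs) \<longleftrightarrow> x \<in> K"
  shows "kernel_dim A = dim K"
proof -
  interpret A: kernel "length bs" "length bs" A
    by unfold_locales fact
  obtain B where B: "B \<subseteq> K" "independent B" "K \<subseteq> span B" "card B = dim K"
    using basis_exists by blast
  have fin: "finite B" using B(2) finiteI_independent by blast
  have sub: "coords ` B \<subseteq> mat_kernel A"
    using B(1) ker by (auto simp: mat_kernel[OF A])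
  have inj: "inj_on coords C" for C by (auto intro: inj_onI)
  have comb: "A.lincomb a (coords ` C) = coords (\<Sum>b\<in>C. a (coords b) *s b)" if "C \<subseteq> B" for a C
  proof (rule eq_vecI)
    have C: "coords ` C \<subseteq> mat_kernel A" "finite C"
      using that sub fin finite_subset by auto
    then have C': "coords ` C \<subseteq> carrier_vec (length bs)" by auto
    show "dim_vec (A.lincomb a (coords ` C)) = dim_vec (coords (\<Sum>b\<in>C. a (coords b) *s b))"
      using A.NC.lincomb_dim[OF finite_imageI[OF C(2)] C'] A.lincomb_same[OF C(1)] by (simp add: coords_def)
    fix i assume "i < dim_vec (coords (\<Sum>b\<in>C. a (coords b) *s b))"
    then have i: "i < length bs" by (simp add: coords_def)
    show "A.lincomb a (coords ` C) $ i = coords (\<Sum>b\<in>C. a (coords b) *s b) $ i"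
      by (simp add: A.lincomb_index[OF i C(1)] coords_sum_index[OF i] sum.reindex[OF inj])
  qed
  have "A.lin_indpt (coords ` B)"
  proof
    assume "A.lin_dep (coords ` B)"
    then obtain U a v where U: "U \<subseteq> coords ` B" "finite U" "A.lincomb a U = 0\<^sub>v (length bs)" "v \<in> U" "a v \<noteq> 0"
      unfolding A.Ker.lin_dep_def by auto
    then obtain C where C: "C \<subseteq> B" "U = coords ` C" by (meson subset_imageE)
    then have sum: "(\<Sum>b\<in>C. a (coords b) *s b) = 0"
      using U(3) comb[OF C(1)] by simp
    have "a (coords b) = 0" if "b \<in> C" for b
      using independentD[where u = "\<lambda>b. a (coords b)", OF B(2) finite_subset[OF C(1) fin] C(1) sum that] .
    then show False using U(4,5) C(2) by auto
  qed
  moreover have "A.span (coords ` B) = mat_kernel A"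
  proof
    show "A.span (coords ` B) \<subseteq> mat_kernel A"
      using A.Ker.span_is_subset2[OF sub] by simp
    show "mat_kernel A \<subseteq> A.span (coords ` B)"
    proof
      fix v assume v: "v \<in> mat_kernel A"
      then obtain x where x: "v = coords x"
        using exists_coords_eq mat_kernelD[OF A v] by metis
      then have "x \<in> span B" using v ker B(3) by (auto simp: mat_kernel[OF A])
      then obtain c where c: "x = (\<Sum>b\<in>B. c b *s b)"
        using span_finite[OF fin] by auto
      have "v = A.lincomb (c \<circ> inv_into B coords) (coords ` B)"
        by (simp add: comb x c inv_into_f_f[OF inj] cong: sum.cong)
      then show "v \<in> A.span (coords ` B)"
        using fin unfolding A.Ker.span_def by (auto intro!: exI[of _ "c \<circ> inv_into B coords"] exI[of _ "coords ` B"])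
    qed
  qed
  ultimately have "A.dim = card (coords ` B)"
    using sub fin by (intro A.Ker.dim_basis) (auto simp: A.Ker.basis_def)
  then show ?thesis
    by (simp add: card_image[OF inj] B(4))
qed

end

section \<open>Semicontinuity of the rank\<close>

context ordered_basis
begin

interpretation endo: finite_dimensional_vector_space_pair scale "set bs" scale "set bs"
  by unfold_locales

lemma op_mat_det_nonzero_iff_inj:
  assumes "Vector_Spaces.linear scale scale T"
  shows "det (op_mat T) \<noteq> 0 \<longleftrightarrow> inj T"
proof -
  have "det (op_mat T) = 0 \<longleftrightarrow> (\<exists>x. x \<noteq> 0 \<and> T x = 0)"
    unfolding det_0_iff_vec_prod_zero_field[OF op_mat_carrier]
    using op_mat_mult_coords[OF assms] exists_coords_eq coords_carrier coords_eq_zero_iff by metis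
  then show ?thesis
    using endo.linear_inj_iff_eq_0[OF assms] by blast
qed

text \<open>
  Stated by coordinates because exactly these polynomials become the entries of the matrix whose
  determinant is taken in \<open>finite_singular_parameters\<close>.
\<close>

definition polynomial_curve :: "('k \<Rightarrow> 'g) \<Rightarrow> bool" where
  "polynomial_curve v \<longleftrightarrow> (\<forall>i<length bs. \<exists>p. \<forall>t. coords (v t) $ i = poly p t)"

lemma polynomial_curve_const: "polynomial_curve (\<lambda>t. x)"
  unfolding polynomial_curve_def by (metis poly_const_conv)

lemma polynomial_curve_add:
  assumes "polynomial_curve v" "polynomial_curve w"
  shows "polynomial_curve (\<lambda>t. v t + w t)"
  using assms unfolding polynomial_curve_def by (metis coords_add_index poly_add)

lemma polynomial_curve_scale:
  assumes "polynomial_curve v"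
  shows "polynomial_curve (\<lambda>t. t *s v t)"
  unfolding polynomial_curve_def
proof (intro allI impI)
  fix i assume i: "i < length bs"
  then obtain p where "\<forall>t. coords (v t) $ i = poly p t"
    using assms unfolding polynomial_curve_def by blast
  then show "\<exists>p. \<forall>t. coords (t *s v t) $ i = poly p t"
    by (intro exI[of _ "pCons 0 p"]) (simp add: coords_scale_index i)
qed

lemma polynomial_curve_linear_image:
  assumes "polynomial_curve v" "Vector_Spaces.linear scale scale T"
  shows "polynomial_curve (\<lambda>t. T (v t))"
  unfolding polynomial_curve_def
proof (intro allI impI)
  fix i assume i: "i < length bs"
  obtain p where p: "\<And>j t. j < length bs \<Longrightarrow> coords (v t) $ j = poly (p j) t"
    using assms(1) unfolding polynomial_curve_def by metis
  show "\<exists>q. \<forall>t. coords (T (v t)) $ i = poly q t"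
  proof (intro exI allI)
    fix t
    show "coords (T (v t)) $ i = poly (\<Sum>j<length bs. Polynomial.smult (coords (T (bs ! j)) $ i) (p j)) t"
      unfolding coords_image_op[OF assms(2) i, of "v t"] poly_sum
      by (intro sum.cong) (auto simp: p)
  qed
qed

text \<open>
  The determinant of the matrix of \<open>L t\<close> is a polynomial in \<open>t\<close>, and it is not the zero polynomial
  since it does not vanish at \<open>s\<close>.
\<close>

lemma finite_singular_parameters:
  assumes lin: "\<And>t. Vector_Spaces.linear scale scale (L t)"
    and curve: "\<And>x. polynomial_curve (\<lambda>t. L t x)"
    and inj: "inj (L s)"
  shows "finite {t. \<not> inj (L t)}"
proof -
  define p where "p i j = (SOME q. \<forall>t. coords (L t (bs ! j)) $ i = poly q t)" for i j
  have p: "coords (L t (bs ! j)) $ i = poly (p i j) t" if "i < length bs" for i j t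
  proof -
    have "\<exists>q. \<forall>t. coords (L t (bs ! j)) $ i = poly q t"
      using curve[of "bs ! j"] that unfolding polynomial_curve_def by blast
    then have "\<forall>t. coords (L t (bs ! j)) $ i = poly (p i j) t"
      unfolding p_def by (rule someI_ex)
    then show ?thesis by blast
  qed
  define M where "M = mat (length bs) (length bs) (\<lambda>(i, j). p i j)"
  have det: "det (op_mat (L t)) = poly (det M) t" for t
  proof -
    have eval: "comm_ring_hom (\<lambda>q. poly q t)"
      by unfold_locales auto
    have "op_mat (L t) = map_mat (\<lambda>q. poly q t) M"
      by (rule eq_matI) (auto simp: op_mat_def M_def p[symmetric] coords_index)
    then show ?thesis
      by (simp only: comm_ring_hom.hom_det[OF eval])
  qed
  have "det M \<noteq> 0"
    using inj op_mat_det_nonzero_iff_inj[OF lin, of s] det[of s] by auto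
  then have "finite {t. poly (det M) t = 0}"
    by (rule poly_roots_finite)
  moreover have "\<not> inj (L t) \<longleftrightarrow> poly (det M) t = 0" for t
    using op_mat_det_nonzero_iff_inj[OF lin, of t] det by auto
  ultimately show ?thesis by simp
qed

text \<open>
  A correction term reduces this to invertibility and so avoids minors. Choose \<open>W\<close> mapped by \<open>P s\<close>
  bijectively to a basis of its range, and a fixed operator \<open>S\<close> that vanishes on \<open>W\<close> and makes
  \<open>P s + S\<close> invertible. Then \<open>P t + S\<close> is invertible for all but finitely many \<open>t\<close>, and for these
  \<open>P t\<close>, which agrees with \<open>P t + S\<close> on \<open>W\<close>, is injective on the span of \<open>W\<close>.
\<close>

lemma finite_rank_drop_parameters:
  assumes lin: "\<And>t. Vector_Spaces.linear scale scale (P t)"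
    and curve: "\<And>x. polynomial_curve (\<lambda>t. P t x)"
  shows "finite {t. dim (range (P t)) < dim (range (P s))}"
proof -
  obtain C where C: "C \<subseteq> range (P s)" "independent C" "range (P s) \<subseteq> span C" "card C = dim (range (P s))"
    by (rule basis_exists)
  define W where "W = inv_into UNIV (P s) ` C"
  have g: "P s (inv_into UNIV (P s) c) = c" if "c \<in> C" for c
    using C(1) that by (auto intro: f_inv_into_f)
  have PW: "P s ` W = C" using g by (force simp: W_def)
  have finW: "finite W" using finiteI_independent[OF C(2)] by (simp add: W_def)
  have cardW: "card W = card C"
    using card_image_le[OF finiteI_independent[OF C(2)], of "inv_into UNIV (P s)"] card_image_le[OF finW, of "P s"]
    unfolding PW by (simp add: W_def)
  have "card C \<le> dim W"
    using endo.dim_image_le[OF lin, of s W] by (simp add: PW dim_eq_card_independent[OF C(2)])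
  then have indW: "independent W"
    using card_le_dim_spanning[of W W] finW cardW span_superset by simp
  define B where "B = extend_basis W"
  define D where "D = extend_basis C"
  have B: "W \<subseteq> B" "independent B" "span B = UNIV" and D: "C \<subseteq> D" "independent D" "span D = UNIV"
    using indW C(2) by (auto simp: B_def D_def extend_basis_superset independent_extend_basis)
  have fin: "finite B" "finite D" using B D finiteI_independent by auto
  have "card B = card D"
    using basis_card_eq_dim[of B UNIV] basis_card_eq_dim[of D UNIV] B D by simp
  then have "card (B - W) = card (D - C)"
    using B(1) D(1) fin cardW by (simp add: card_Diff_subset finite_subset)
  then obtain h where h: "bij_betw h (B - W) (D - C)"
    using fin by (meson finite_Diff finite_same_card_bij)
  define S where "S = endo.construct B (\<lambda>b. if b \<in> W then 0 else h b)"
  have S: "Vector_Spaces.linear scale scale S"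
    unfolding S_def by (rule endo.linear_construct[OF B(2)])
  have S_W: "S b = 0" if "b \<in> W" for b
    using that B by (auto simp: S_def endo.construct_basis)
  have S_B: "S b = h b" if "b \<in> B - W" for b
    using that B by (auto simp: S_def endo.construct_basis)
  define L where "L = (\<lambda>t x. P t x + S x)"
  have L: "Vector_Spaces.linear scale scale (L t)" for t
    unfolding L_def by (rule endo.linear_compose_add[OF lin S])
  have sub: "subspace (range (L s))"
    using endo.linear_subspace_image[OF L subspace_UNIV] .
  have "L s ` W = C"
    using PW S_W by (force simp: L_def)
  then have C_L: "C \<subseteq> range (L s)" by auto
  \<comment> \<open>For a vector of \<open>D\<close> outside \<open>C\<close>, the part \<open>P s b\<close> of \<open>L s b\<close> lies in the span of \<open>C\<close>, which is already reached.\<close>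
  have "d \<in> range (L s)" if "d \<in> D" for d
  proof (cases "d \<in> C")
    case True
    then show ?thesis using C_L by auto
  next
    case False
    then have "d \<in> h ` (B - W)"
      using that bij_betw_imp_surj_on[OF h] by simp
    then obtain b where b: "b \<in> B - W" "d = h b"
      by (rule imageE)
    have "P s b \<in> range (L s)"
      using C(3) span_minimal[OF C_L sub] by auto
    then have "L s b - P s b \<in> range (L s)"
      by (intro subspace_diff[OF sub]) auto
    then show ?thesis
      using S_B[OF b(1)] b(2) by (simp add: L_def)
  qed
  then have "span D \<subseteq> range (L s)"
    by (intro span_minimal sub) auto
  then have "inj (L s)"
    using D(3) by (intro linear_surj_imp_inj[OF L]) auto
  then have "finite {t. \<not> inj (L t)}"
    by (intro finite_singular_parameters[OF L, where s = s])
      (auto simp: L_def intro: polynomial_curve_add polynomial_curve_const curve)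
  moreover have "dim (range (P s)) \<le> dim (range (P t))" if "inj (L t)" for t
  proof -
    have "dim (range (P s)) = dim W"
      using cardW C(4) dim_eq_card_independent[OF indW] by simp
    also have "\<dots> = dim (L t ` W)"
      using endo.dim_image_eq[OF L] that by (metis inj_on_subset subset_UNIV)
    also have "L t ` W = P t ` W"
      using S_W by (force simp: L_def)
    also have "dim (P t ` W) \<le> dim (range (P t))"
      by (rule dim_subset) auto
    finally show ?thesis .
  qed
  then have "{t. dim (range (P t)) < dim (range (P s))} \<subseteq> {t. \<not> inj (L t)}"
    by (meson Collect_mono not_le)
  ultimately show ?thesis
    using finite_subset by blast
qed

lemma dim_range_plus_dim_kernel:
  assumes "Vector_Spaces.linear scale scale T"
  shows "dim (range T) + dim {x. T x = 0} = dim UNIV"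
proof -
  interpret T: Vector_Spaces.linear scale scale T by fact
  obtain K where K: "K \<subseteq> {x. T x = 0}" "independent K" "{x. T x = 0} \<subseteq> span K" "card K = dim {x. T x = 0}"
    by (rule basis_exists)
  define B where "B = extend_basis K"
  have B: "K \<subseteq> B" "independent B" "span B = UNIV"
    using K(2) by (auto simp: B_def extend_basis_superset independent_extend_basis)
  have fin: "finite B" using B finiteI_independent by auto
  have indep: "independent (B - K)" using B(2) independent_mono by blast
  have "x = 0" if x: "x \<in> span (B - K)" "T x = 0" for x
  proof -
    have "x \<in> span K" using x K(3) by auto
    then have "representation B x = representation K x"
      by (rule representation_extend[OF B(2) _ B(1)])
    moreover have "representation B x = representation (B - K) x"
      using Diff_subset by (rule representation_extend[OF B(2) x(1)])
    ultimately have "representation B x b = 0" for b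
      using representation_ne_zero[of K x b] representation_ne_zero[of "B - K" x b] by auto
    then show "x = 0"
      using sum_nonzero_representation_eq[OF B(2), of x] B(3) by simp
  qed
  then have inj: "inj_on T (span (B - K))"
    using T.inj_on_iff_eq_0[OF subspace_span] by auto
  have "range T = T ` span B" by (simp add: B(3))
  also have "\<dots> = span (T ` B)" by (simp add: T.span_image)
  also have "T ` B = T ` K \<union> T ` (B - K)" using B(1) by auto
  also have "span \<dots> = span (T ` (B - K))"
  proof -
    have "T ` K \<subseteq> span (T ` (B - K))"
      using K(1) by (auto simp: span_zero)
    then have "T ` K \<union> T ` (B - K) \<subseteq> span (T ` (B - K))"
      using span_superset by (rule Un_least)
    moreover have "T ` (B - K) \<subseteq> span (T ` K \<union> T ` (B - K))"
      using span_superset[of "T ` K \<union> T ` (B - K)"] by simp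
    ultimately show ?thesis
      unfolding span_eq by (rule conjI)
  qed
  finally have "dim (range T) = dim (T ` (B - K))" by simp
  also have "\<dots> = card (B - K)"
    using endo.dim_image_eq[OF assms inj] dim_eq_card_independent[OF indep] by simp
  also have "\<dots> = card B - card K"
    using B(1) fin by (simp add: card_Diff_subset finite_subset)
  finally show ?thesis
    using K(4) card_mono[OF fin B(1)] basis_card_eq_dim[of B UNIV] B by simp
qed

end

section \<open>Jordan block sizes of nilpotent operators\<close>

text \<open>
  Over any field a nilpotent operator is triangular in some basis. An independent list in which \<open>T\<close>
  sends each vector into the span of the earlier ones, and which does not yet span, can be extended:
  apply \<open>T\<close> repeatedly to a vector outside the span and append the last iterate before the span is
  first reached. A list of maximal length is therefore a basis.
\<close>

lemma (in finite_dimensional_vector_space) exists_triangularizing_list: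
  assumes nil: "\<And>x. (T ^^ m) x = 0"
  shows "\<exists>bs. distinct bs \<and> independent (set bs) \<and> span (set bs) = UNIV \<and>
           (\<forall>j<length bs. T (bs ! j) \<in> span (set (take j bs)))"
proof -
  define Q where "Q bs \<longleftrightarrow> distinct bs \<and> independent (set bs) \<and>
      (\<forall>j<length bs. T (bs ! j) \<in> span (set (take j bs)))" for bs
  have "Q []" by (simp add: Q_def independent_empty)
  moreover have "length bs < Suc (dim UNIV)" if "Q bs" for bs
    using that independent_card_le_dim[of "set bs" UNIV] by (simp add: Q_def distinct_card)
  ultimately obtain bs where Q: "Q bs" and max: "\<And>cs. Q cs \<Longrightarrow> length cs \<le> length bs"
    using ex_has_greatest_nat[of Q "[]" length "Suc (dim UNIV)"] by blast
  have "v \<in> span (set bs)" for v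
  proof (rule ccontr)
    assume v: "v \<notin> span (set bs)"
    define l where "l = (LEAST l. (T ^^ l) v \<in> span (set bs))"
    have "(T ^^ m) v \<in> span (set bs)" by (simp add: nil span_zero)
    then have l: "(T ^^ l) v \<in> span (set bs)"
      unfolding l_def by (rule LeastI)
    with v obtain k where k: "l = Suc k" by (cases l) auto
    define w where "w = (T ^^ k) v"
    have w: "w \<notin> span (set bs)"
      using not_less_Least[of k "\<lambda>l. (T ^^ l) v \<in> span (set bs)"] k by (simp add: l_def w_def)
    have Tw: "T w \<in> span (set bs)"
      using l by (simp add: k w_def)
    have "Q (bs @ [w])"
      using Q w Tw span_base[of w "set bs"]
      by (auto simp: Q_def independent_insert nth_append less_Suc_eq)
    then show False using max by force
  qed
  then show ?thesis using Q by (auto simp: Q_def)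
qed

lemma (in vector_space) linear_funpow:
  assumes "Vector_Spaces.linear scale scale T"
  shows "Vector_Spaces.linear scale scale (T ^^ j)"
proof (induction j)
  case 0
  show ?case unfolding funpow.simps(1) by (rule linear_id)
next
  case (Suc j)
  show ?case unfolding funpow.simps(2) by (rule Vector_Spaces.linear_compose[OF Suc assms])
qed

context ordered_basis
begin

interpretation endo: vector_space_pair scale scale
  by unfold_locales

lemma upper_triangular_op_mat:
  assumes "\<And>j. j < length bs \<Longrightarrow> T (bs ! j) \<in> span (set (take j bs))"
  shows "upper_triangular (op_mat T)"
proof -
  have "representation (set bs) (T (bs ! j)) (bs ! i) = 0" if ij: "i < length bs" "j < i" for i j
  proof -
    have j: "j < length bs" using ij by simp
    have "bs ! i \<notin> set (take j bs)"
      using ij distinct_bs by (auto simp: in_set_conv_nth nth_eq_iff_index_eq)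
    then show ?thesis
      using representation_extend[OF independent_bs assms[OF j] set_take_subset]
        representation_ne_zero[of "set (take j bs)" "T (bs ! j)" "bs ! i"] by auto
  qed
  then show ?thesis by (auto simp: op_mat_def)
qed

lemma jordan_nf_eigenvalue_zero:
  assumes lin: "Vector_Spaces.linear scale scale T" and nil: "\<And>x. (T ^^ m) x = 0"
    and jnf: "jordan_nf (op_mat T) n_as" and na: "(n, a) \<in> set n_as"
  shows "a = 0"
proof -
  interpret T: Vector_Spaces.linear scale scale T by fact
  have "n \<noteq> 0" using jnf na by (force simp: jordan_nf_def)
  have "[:- a, 1:] ^ n \<in> set (map (\<lambda>(n, a). [:- a, 1:] ^ n) n_as)"
    using na by force
  then have "[:- a, 1:] ^ n dvd char_poly (op_mat T)"
    unfolding jordan_nf_char_poly[OF jnf] by (rule prod_list_dvd)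
  moreover have "[:- a, 1:] dvd [:- a, 1:] ^ n" using \<open>n \<noteq> 0\<close> by (simp add: dvd_power)
  ultimately have "poly (char_poly (op_mat T)) a = 0"
    unfolding poly_eq_0_iff_dvd using dvd_trans by blast
  then have "eigenvalue (op_mat T) a"
    using eigenvalue_root_char_poly[OF op_mat_carrier] by blast
  then obtain v where v: "v \<in> carrier_vec (length bs)" "v \<noteq> 0\<^sub>v (length bs)" "op_mat T *\<^sub>v v = a \<cdot>\<^sub>v v"
    by (auto simp: eigenvalue_def eigenvector_def op_mat_def)
  obtain x where x: "coords x = v" using exists_coords_eq[OF v(1)] by blast
  have "coords (a *s x) = a \<cdot>\<^sub>v coords x"
    by (rule eq_vecI) (auto simp: coords_scale_index)
  then have Tx: "T x = a *s x"
    using v(3) op_mat_mult_coords[OF lin, of x] x by (metis coords_eq_iff)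
  have "(T ^^ k) x = (a ^ k) *s x" for k
    by (induction k) (simp_all add: Tx T.scale mult.commute)
  then have "(a ^ m) *s x = 0" using nil by metis
  then show ?thesis using v(2) x by auto
qed

text \<open>
  A block of size \<open>n\<close> with eigenvalue \<open>0\<close> contributes \<open>min j n\<close> to the kernel of the \<open>j\<close>-th power, and
  by nilpotency every block has eigenvalue \<open>0\<close>. The right-hand side does not mention the basis.
\<close>

lemma sum_min_block_sizes_eq_dim_kernel:
  assumes lin: "Vector_Spaces.linear scale scale T" and nil: "\<And>x. (T ^^ m) x = 0"
    and jnf: "jordan_nf (op_mat T) n_as"
  shows "(\<Sum>n\<leftarrow>map fst n_as. min j n) = dim {x. (T ^^ j) x = 0}"
proof -
  have "subspace {x. (T ^^ j) x = 0}"
    by (rule endo.linear_subspace_kernel[OF linear_funpow[OF lin]])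
  then have "dim {x. (T ^^ j) x = 0} = kernel_dim (op_mat T ^\<^sub>m j)"
    by (intro kernel_dim_eq_dim[symmetric]) (auto simp: op_mat_pow_mult_coords[OF lin])
  moreover have "char_matrix (op_mat T) 0 = op_mat T"
    by (rule eq_matI) (auto simp: char_matrix_def op_mat_def)
  moreover have "filter (\<lambda>(n, a). a = 0) n_as = n_as"
    using jordan_nf_eigenvalue_zero[OF lin nil jnf] by (auto intro: filter_True)
  ultimately show ?thesis
    using dim_gen_eigenspace[OF jnf, of 0 j] by (simp add: dim_gen_eigenspace_def)
qed

end

lemma sum_list_rev_sort: "(\<Sum>n\<leftarrow>rev (sort ns). f n) = (\<Sum>n\<leftarrow>ns. f n)"
  for f :: "'a::linorder \<Rightarrow> 'b::comm_monoid_add"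
  by (metis mset_map mset_rev mset_sort sum_mset_sum_list)

context finite_dimensional_lie_algebra
begin

lemma exists_ordered_basis: "\<exists>bs. is_ordered_basis bs"
proof -
  obtain B where B: "finite B" "span B = UNIV" using finite_dimensional by blast
  obtain C where C: "C \<subseteq> B" "independent C" "B \<subseteq> span C"
    by (rule maximal_independent_subset)
  have "span C = UNIV"
    using span_minimal[OF C(3) subspace_span] B(2) by auto
  moreover obtain bs where "set bs = C" "distinct bs"
    using finite_distinct_list finite_subset[OF C(1) B(1)] by blast
  ultimately show ?thesis
    using C(2) by (auto simp: is_ordered_basis_def)
qed

text \<open>
  This is where the definite description in \<open>jordan_block_sizes\<close> is shown to be meaningful: some basis
  admits a Jordan normal form, namely a triangularizing one, and the kernel dimensions force the same
  sizes for all bases.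
\<close>

lemma jordan_block_sizes_nilpotent:
  assumes lin: "Vector_Spaces.linear scale scale T" and nil: "\<And>x. (T ^^ m) x = 0"
  shows sorted_jordan_block_sizes: "sorted_wrt (\<ge>) (jordan_block_sizes T)"
    and zero_notin_jordan_block_sizes: "0 \<notin> set (jordan_block_sizes T)"
    and sum_min_jordan_block_sizes:
      "(\<Sum>n\<leftarrow>jordan_block_sizes T. min j n) = dim {x. (T ^^ j) x = 0}"
proof -
  define R where "R ns \<longleftrightarrow> (\<exists>bs n_as. is_ordered_basis bs \<and> jordan_nf (matrix_of bs T) n_as \<and>
                ns = rev (sort (map fst n_as)))" for ns
  define ok where "ok ns \<longleftrightarrow> sorted_wrt (\<ge>) ns \<and> 0 \<notin> set ns \<and>
     (\<forall>j. (\<Sum>n\<leftarrow>ns. min j n) = dim {x. (T ^^ j) x = 0})" for ns :: "nat list"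
  have op_mat: "ordered_basis.op_mat scale bs T = matrix_of bs T" if "ordered_basis scale bs" for bs
    using that by (simp add: ordered_basis.op_mat_def matrix_of_def)
  have R_ok: "ok ns" if R: "R ns" for ns
  proof -
    obtain bs n_as where bs: "is_ordered_basis bs" and jnf: "jordan_nf (matrix_of bs T) n_as"
      and ns: "ns = rev (sort (map fst n_as))"
      using R by (auto simp: R_def)
    interpret b: ordered_basis scale bs
      using bs by unfold_locales (auto simp: is_ordered_basis_def)
    have "(\<Sum>n\<leftarrow>ns. min j n) = dim {x. (T ^^ j) x = 0}" for j
      using b.sum_min_block_sizes_eq_dim_kernel[OF lin nil, of n_as j] jnf
      unfolding ns sum_list_rev_sort op_mat[OF b.ordered_basis_axioms] by simp
    moreover have "0 \<notin> set ns"
      using jnf by (auto simp: ns jordan_nf_def)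
    moreover have "sorted_wrt (\<ge>) ns"
      by (simp add: ns sorted_wrt_rev)
    ultimately show ?thesis by (simp add: ok_def)
  qed
  have "\<exists>ns. R ns"
  proof -
    obtain cs where "is_ordered_basis cs" using exists_ordered_basis by blast
    then interpret c: ordered_basis scale cs
      by unfold_locales (auto simp: is_ordered_basis_def)
    obtain bs where bs: "distinct bs" "independent (set bs)" "span (set bs) = UNIV"
      and flag: "\<And>j. j < length bs \<Longrightarrow> T (bs ! j) \<in> span (set (take j bs))"
      using c.exists_triangularizing_list[OF nil] by blast
    interpret b: ordered_basis scale bs
      using bs by unfold_locales
    have "jordan_nf (b.op_mat T) (triangular_to_jnf_vector (b.op_mat T))"
      using triangular_to_jnf_vector[OF b.op_mat_carrier b.upper_triangular_op_mat[OF flag]] .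
    then show ?thesis
      using bs op_mat[OF b.ordered_basis_axioms] by (auto simp: R_def is_ordered_basis_def)
  qed
  moreover have "ns = ms" if "R ns" "R ms" for ns ms
    using R_ok[OF that(1)] R_ok[OF that(2)] by (intro min_sums_eq_imp_eq) (auto simp: ok_def)
  ultimately have "R (THE ns. R ns)"
    by (metis theI)
  moreover have "jordan_block_sizes T = (THE ns. R ns)"
    by (simp add: jordan_block_sizes_def R_def)
  ultimately have "ok (jordan_block_sizes T)"
    using R_ok by simp
  then show "sorted_wrt (\<ge>) (jordan_block_sizes T)" "0 \<notin> set (jordan_block_sizes T)"
    "(\<Sum>n\<leftarrow>jordan_block_sizes T. min j n) = dim {x. (T ^^ j) x = 0}"
    by (simp_all add: ok_def)
qed

end

section \<open>Adjoint operators of a nilpotent Lie algebra\<close>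

context finite_dimensional_lie_algebra
begin

lemma sum_list_jordan_block_sizes:
  assumes lin: "Vector_Spaces.linear scale scale T" and nil: "\<And>x. (T ^^ m) x = 0"
  shows "sum_list (jordan_block_sizes T) = dim UNIV"
proof -
  \<comment> \<open>The exponent \<open>m + N\<close> annihilates everything and is at least as large as every block.\<close>
  define N where "N = sum_list (jordan_block_sizes T)"
  have "(T ^^ (m + N)) x = 0" for x
    by (simp add: funpow_add nil)
  moreover have "map (min (m + N)) (jordan_block_sizes T) = jordan_block_sizes T"
    by (auto intro!: map_idI simp: N_def dest: member_le_sum_list)
  ultimately show ?thesis
    using sum_min_jordan_block_sizes[OF lin nil, of "m + N"] by simp
qed

lemma rank_plus_length_jordan_block_sizes:
  assumes lin: "Vector_Spaces.linear scale scale T" and nil: "\<And>x. (T ^^ m) x = 0"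
  shows "rank T + length (jordan_block_sizes T) = dim UNIV"
proof -
  obtain bs where "is_ordered_basis bs" using exists_ordered_basis by blast
  then interpret b: ordered_basis scale bs
    by unfold_locales (auto simp: is_ordered_basis_def)
  have "min 1 n = 1" if "n \<in> set (jordan_block_sizes T)" for n
    using zero_notin_jordan_block_sizes[OF lin nil] that by (cases n) auto
  then have "map (min 1) (jordan_block_sizes T) = map (\<lambda>_. 1) (jordan_block_sizes T)"
    by simp
  then have "(\<Sum>n\<leftarrow>jordan_block_sizes T. min 1 n) = length (jordan_block_sizes T)"
    by (simp only: sum_list_triv) simp
  then have "length (jordan_block_sizes T) = dim {x. T x = 0}"
    using sum_min_jordan_block_sizes[OF lin nil, of 1] by simp
  then show ?thesis
    using b.dim_range_plus_dim_kernel[OF lin] by (simp add: rank_def)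
qed

text \<open>
  Larger ranks mean smaller kernels of all powers, which is dominance of the block sizes.
\<close>

lemma jordan_block_sizes_mono:
  assumes T: "Vector_Spaces.linear scale scale T" "\<And>x. (T ^^ m) x = 0"
    and S: "Vector_Spaces.linear scale scale S" "\<And>x. (S ^^ m) x = 0"
    and le: "\<And>j. rank (T ^^ j) \<le> rank (S ^^ j)"
  shows "jordan_block_sizes T \<le> jordan_block_sizes S"
proof (rule lex_le_if_min_sums_ge)
  obtain bs where "is_ordered_basis bs" using exists_ordered_basis by blast
  then interpret b: ordered_basis scale bs
    by unfold_locales (auto simp: is_ordered_basis_def)
  show "(\<Sum>n\<leftarrow>jordan_block_sizes S. min j n) \<le> (\<Sum>n\<leftarrow>jordan_block_sizes T. min j n)" for j
    using le[of j] b.dim_range_plus_dim_kernel[OF linear_funpow[OF T(1)], of j]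
      b.dim_range_plus_dim_kernel[OF linear_funpow[OF S(1)], of j]
    by (simp add: sum_min_jordan_block_sizes[OF T] sum_min_jordan_block_sizes[OF S] rank_def)
qed (simp_all add: sorted_jordan_block_sizes[OF S] zero_notin_jordan_block_sizes[OF T]
      sum_list_jordan_block_sizes[OF T] sum_list_jordan_block_sizes[OF S])

lemma linear_ad: "Vector_Spaces.linear scale scale (ad x)"
  unfolding ad_def by (rule bracket_linear_right)

lemma ad_line: "ad (x + t *s u) y = ad x y + t *s ad u y"
proof -
  interpret l: Vector_Spaces.linear scale scale "\<lambda>x. bracket x y"
    by (rule bracket_linear_left)
  show ?thesis by (simp add: ad_def l.add l.scale)
qed

lemma ad_nilpotent:
  assumes "nilpotent"
  shows "\<exists>m. \<forall>x y. (ad x ^^ m) y = 0"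
proof -
  have "(ad x ^^ m) y \<in> lower_central m" for x y m
    by (induction m) (auto simp: ad_def bracket_span_def intro!: span_base)
  then show ?thesis
    using assms by (metis nilpotent_def singletonD)
qed

lemma finite_ad_rank_drop_parameters:
  "finite {t. rank (ad (x + t *s u) ^^ j) < rank (ad (x + s *s u) ^^ j)}"
proof -
  obtain bs where "is_ordered_basis bs" using exists_ordered_basis by blast
  then interpret b: ordered_basis scale bs
    by unfold_locales (auto simp: is_ordered_basis_def)
  have "b.polynomial_curve (\<lambda>t. (ad (x + t *s u) ^^ j) y)" for y
  proof (induction j)
    case 0
    show ?case by (simp add: b.polynomial_curve_const)
  next
    case (Suc j)
    have "b.polynomial_curve (\<lambda>t. ad x ((ad (x + t *s u) ^^ j) y) + t *s ad u ((ad (x + t *s u) ^^ j) y))"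
      by (intro b.polynomial_curve_add b.polynomial_curve_scale
          b.polynomial_curve_linear_image[OF _ linear_ad] Suc)
    moreover have "(ad (x + t *s u) ^^ Suc j) y =
        ad x ((ad (x + t *s u) ^^ j) y) + t *s ad u ((ad (x + t *s u) ^^ j) y)" for t
      unfolding funpow.simps(2) comp_apply by (rule ad_line)
    ultimately show ?case by (simp only:)
  qed
  then show ?thesis
    unfolding rank_def by (intro b.finite_rank_drop_parameters linear_funpow linear_ad)
qed

lemma subspace_derived_subalgebra: "subspace derived_subalgebra"
  by (simp add: derived_subalgebra_def bracket_span_def subspace_span)

text \<open>
  A line through a point outside a subspace meets the subspace at most once.
\<close>

lemma finite_derived_parameters:
  assumes "x \<notin> derived_subalgebra"
  shows "finite {t. x + t *s u \<in> derived_subalgebra}"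
proof -
  have "s = t" if s: "x + s *s u \<in> derived_subalgebra" and t: "x + t *s u \<in> derived_subalgebra" for s t
  proof (rule ccontr)
    assume "s \<noteq> t"
    have "(x + s *s u) - (x + t *s u) \<in> derived_subalgebra"
      by (intro subspace_diff subspace_derived_subalgebra s t)
    then have "(s - t) *s u \<in> derived_subalgebra"
      by (simp add: scale_left_diff_distrib)
    then have "inverse (s - t) *s ((s - t) *s u) \<in> derived_subalgebra"
      by (rule subspace_scale[OF subspace_derived_subalgebra])
    then have "u \<in> derived_subalgebra" using \<open>s \<noteq> t\<close> by simp
    then have "(x + s *s u) - s *s u \<in> derived_subalgebra"
      by (intro subspace_diff subspace_scale subspace_derived_subalgebra s)
    then show False using assms by simp
  qed
  then have "{t. x + t *s u \<in> derived_subalgebra} \<subseteq> {s}" if "x + s *s u \<in> derived_subalgebra" for s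
    using that by blast
  then show ?thesis
    by (cases "\<exists>s. x + s *s u \<in> derived_subalgebra") (auto intro: finite_subset)
qed

text \<open>
  From the \<open>m\<close>-th power on, all ranks are \<open>0\<close>, so finitely many finite sets of parameters have to be
  avoided. The line starts at \<open>x\<close> for \<open>t = 0\<close> and passes through \<open>y\<close> for \<open>t = 1\<close>; rank drops are
  measured against both of these points.
\<close>

lemma exists_common_rank_bound:
  assumes inf: "infinite (UNIV :: 'a set)" and nilp: "nilpotent" and x: "x \<notin> derived_subalgebra"
  shows "\<exists>z. z \<notin> derived_subalgebra \<and> (\<forall>j. rank (ad x ^^ j) \<le> rank (ad z ^^ j)) \<and>
           rank (ad y) \<le> rank (ad z)"
proof -
  obtain m where m: "\<And>x y. (ad x ^^ m) y = 0" using ad_nilpotent[OF nilp] by blast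
  define z where "z t = x + t *s (y - x)" for t
  define bad where "bad = {t. z t \<in> derived_subalgebra} \<union>
    (\<Union>j<m. {t. rank (ad (z t) ^^ j) < rank (ad (z 0) ^^ j)}) \<union>
    {t. rank (ad (z t) ^^ 1) < rank (ad (z 1) ^^ 1)}"
  have "finite bad"
    unfolding bad_def z_def
    by (intro finite_UnI finite_UN_I finite_lessThan finite_ad_rank_drop_parameters
        finite_derived_parameters x)
  then obtain t where t: "t \<notin> bad" using inf by (metis UNIV_eq_I)
  have "rank (ad x ^^ j) \<le> rank (ad (z t) ^^ j)" for j
  proof (cases "j < m")
    case True
    then show ?thesis using t by (auto simp: bad_def z_def not_less)
  next
    case False
    then obtain i where j: "j = m + i"
      using le_Suc_ex not_less by blast
    have "ad x ^^ j = ad (z t) ^^ j"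
      by (rule ext) (simp add: j funpow_add m)
    then show ?thesis by simp
  qed
  moreover have "rank (ad y) \<le> rank (ad (z t))"
    using t by (auto simp: bad_def z_def not_less)
  moreover have "z t \<notin> derived_subalgebra" using t by (auto simp: bad_def)
  ultimately show ?thesis by blast
qed

text \<open>
  The element \<open>x\<close> realising the characteristic sequence has maximal rank: the element \<open>z\<close> obtained for
  \<open>x\<close> and a competitor \<open>y\<close> has block sizes that are lexicographically at least those of \<open>x\<close>, hence
  equal to them.
\<close>

lemma breadth_plus_length_characteristic_sequence:
  assumes inf: "infinite (UNIV :: 'a set)" and nilp: "nilpotent" and D: "derived_subalgebra \<noteq> UNIV"
  shows "breadth + length characteristic_sequence = sum_list characteristic_sequence"
proof -
  obtain m where m: "\<And>x y. (ad x ^^ m) y = 0" using ad_nilpotent[OF nilp] by blast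
  let ?A = "{jordan_block_sizes (ad x) |x. x \<notin> derived_subalgebra}"
  have "?A \<subseteq> {ns. set ns \<subseteq> {..dim UNIV} \<and> length ns \<le> dim UNIV}"
  proof safe
    fix x
    let ?ns = "jordan_block_sizes (ad x)"
    show "length ?ns \<le> dim UNIV"
      using rank_plus_length_jordan_block_sizes[OF linear_ad m, of x] by simp
    fix n assume "n \<in> set ?ns"
    then show "n \<le> dim UNIV"
      using member_le_sum_list[of n ?ns] sum_list_jordan_block_sizes[OF linear_ad m, of x] by simp
  qed
  then have fin: "finite ?A"
    using finite_lists_length_le[of "{..dim UNIV}"] finite_subset by blast
  have "Max ?A \<in> ?A"
    using fin D by (intro Max_in) auto
  then obtain x where x: "x \<notin> derived_subalgebra" and c: "characteristic_sequence = jordan_block_sizes (ad x)"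
    using D by (auto simp: characteristic_sequence_def)
  have x_max: "jordan_block_sizes (ad z) \<le> jordan_block_sizes (ad x)" if "z \<notin> derived_subalgebra" for z
    using Max_ge[OF fin] that D c by (auto simp: characteristic_sequence_def)
  have "rank (ad y) \<le> rank (ad x)" for y
  proof -
    obtain z where z: "z \<notin> derived_subalgebra" "\<And>j. rank (ad x ^^ j) \<le> rank (ad z ^^ j)"
      "rank (ad y) \<le> rank (ad z)"
      using exists_common_rank_bound[OF inf nilp x] by blast
    have "jordan_block_sizes (ad x) = jordan_block_sizes (ad z)"
      using jordan_block_sizes_mono[OF linear_ad m linear_ad m z(2)] x_max[OF z(1)] by simp
    then have "rank (ad x) = rank (ad z)"
      using rank_plus_length_jordan_block_sizes[OF linear_ad m, of x]
        rank_plus_length_jordan_block_sizes[OF linear_ad m, of z] by simp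
    then show ?thesis using z(3) by simp
  qed
  then have ranks: "{rank (ad y) |y. True} \<subseteq> {..rank (ad x)}"
    by auto
  then have "breadth = rank (ad x)"
    unfolding breadth_def by (intro Max_eqI finite_subset[OF ranks]) auto
  then show ?thesis
    using rank_plus_length_jordan_block_sizes[OF linear_ad m, of x]
      sum_list_jordan_block_sizes[OF linear_ad m, of x] by (simp add: c)
qed

end

theorem theorem4:
  fixes scale :: "'k::field_char_0 \<Rightarrow> 'g::ab_group_add \<Rightarrow> 'g"
    and bracket :: "'g \<Rightarrow> 'g \<Rightarrow> 'g"
    and c :: "nat \<Rightarrow> nat"
    and k :: nat
  assumes "finite_dimensional_lie_algebra scale bracket"
    and "lie_algebra.nilpotent scale bracket"
    and "lie_algebra.characteristic_sequence scale bracket = map c [1..<Suc k] @ [1]"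
  shows "int (lie_algebra.breadth scale bracket) = (\<Sum>i=1..k. int (c i)) - int k"
proof -
  interpret finite_dimensional_lie_algebra scale bracket by fact
  \<comment> \<open>If the derived subalgebra is everything, the characteristic sequence is empty and cannot end in \<open>1\<close>.\<close>
  have "derived_subalgebra \<noteq> UNIV"
    using assms(3) by (auto simp: characteristic_sequence_def)
  moreover have "length characteristic_sequence = k + 1"
    unfolding assms(3) by (simp del: upt_Suc)
  moreover have "sum_list characteristic_sequence = (\<Sum>i=1..k. c i) + 1"
    unfolding assms(3)
    by (simp add: interv_sum_list_conv_sum_set_nat atLeastLessThanSuc_atLeastAtMost del: upt_Suc)
  ultimately have "breadth + (k + 1) = (\<Sum>i=1..k. c i) + 1"
    using breadth_plus_length_characteristic_sequence[OF infinite_UNIV_char_0 assms(2)] by simp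
  then have "int breadth + int k = (\<Sum>i=1..k. int (c i))"
    by (simp flip: of_nat_sum of_nat_add)
  then show ?thesis by simp
qed

end
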